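(* Let $g\geq t>0$ be integers with $t\geq (2g-1)/3$ (or equivalently $g\leq (3t+1)/2$). (a) If $\Lambda$ is any numerical semigroup of genus $g$ and type $t$, then $$\Gamma=\{0\}\cup \{x+1: 0\neq x\in \Lambda\}$$ is a numerical semigroup of genus $g+1$ and type $t+1$. (b) If $\Gamma$ is any numerical semigroup of genus $g+1$ and type $t+1$, then $$\Lambda=\{0\} \cup \{x-1: 0\neq x \in \Gamma\}$$ is a numerical semigroup of genus $g$ and type $t$.
   Context: A numerical semigroup $\Lambda$ is a subset of $\mathbb{N}_0$ containing $0$, closed under addition, with finite complement in $\mathbb{N}_0$. The genus $g(\Lambda)$ is $|\mathbb{N}_0\setminus\Lambda|$. The set of pseudo-Frobenius numbers is $PF(\Lambda)=\{x\in\mathbb{Z}\setminus\Lambda : x+\lambda\in\Lambda \text{ for all } \lambda\in\Lambda\setminus\{0\}\}$ and the type is $t(\Lambda)=|PF(\Lambda)|$. *)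

theory Defs
  imports Complex_Main
begin

definition numerical_semigroup :: "nat set \<Rightarrow> bool" where
  "numerical_semigroup S \<longleftrightarrow>
     0 \<in> S \<and> (\<forall>x\<in>S. \<forall>y\<in>S. x + y \<in> S) \<and> finite (- S)"

definition genus :: "nat set \<Rightarrow> nat" where
  "genus S = card (- S)"

text \<open>
  Pseudo-Frobenius numbers range over all integers, so that the semigroup of all
  natural numbers has \<open>- 1\<close> as its only pseudo-Frobenius number, and hence type 1.
  The image \<open>int ` S\<close> is \<open>S\<close> viewed as a set of integers.
\<close>

definition pseudo_frobenius :: "nat set \<Rightarrow> int set" where
  "pseudo_frobenius S =
     {x. x \<notin> int ` S \<and> (\<forall>l \<in> S - {0}. x + int l \<in> int ` S)}"

definition semigroup_type :: "nat set \<Rightarrow> nat" where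
  "semigroup_type S = card (pseudo_frobenius S)"

end

theory Submission imports Defs begin

text \<open>
  Let \<open>m\<close> be the multiplicity of a numerical semigroup, \<open>t\<close> its type and \<open>n\<close> the number of gaps that
  are not pseudo-Frobenius. If some gap \<open>f\<close> is at least \<open>2 m\<close>, then \<open>p \<mapsto> p - m\<close> maps the
  pseudo-Frobenius numbers above \<open>m\<close> into these \<open>n\<close> gaps, while \<open>p \<mapsto> f - m - p\<close> maps those below \<open>m\<close>
  into them and misses \<open>f - m\<close> and \<open>f - 2 m\<close>; hence \<open>t + 2 \<le> 2 n\<close>, against the hypothesis. So all
  gaps are below \<open>2 m\<close>. In that case every gap above \<open>m\<close> is pseudo-Frobenius, so shifting moves these
  up by one, keeps the pseudo-Frobenius numbers below \<open>m\<close>, and adds \<open>m\<close> as a new one.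
  The downward shift is closed under addition only if \<open>2 m - 1\<close> is not a gap either; the same count
  gives \<open>t + 1 \<le> 2 n\<close> for \<open>f = 2 m - 1\<close>, which genus \<open>g + 1\<close> and type \<open>t + 1\<close> exclude.
\<close>

section \<open>Pseudo-Frobenius numbers among the gaps\<close>

definition pf_gaps :: "nat set \<Rightarrow> nat set" where
  "pf_gaps S = {x. x \<notin> S \<and> (\<forall>l \<in> S - {0}. x + l \<in> S)}"

definition shift_up :: "nat set \<Rightarrow> nat set" where
  "shift_up S = {0} \<union> {x + 1 | x. x \<noteq> 0 \<and> x \<in> S}"

definition shift_down :: "nat set \<Rightarrow> nat set" where
  "shift_down S = {0} \<union> {x - 1 | x. x \<noteq> 0 \<and> x \<in> S}"

definition is_multiplicity :: "nat set \<Rightarrow> nat \<Rightarrow> bool" where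
  "is_multiplicity S m \<longleftrightarrow> m \<in> S \<and> 0 < m \<and> (\<forall>x\<in>S. x \<noteq> 0 \<longrightarrow> m \<le> x)"

lemma pf_gaps_subset: "pf_gaps S \<subseteq> - S"
  by (auto simp: pf_gaps_def)

text \<open>A negative pseudo-Frobenius number \<open>x\<close> would send \<open>F - x\<close>, an
  element beyond the largest gap \<open>F\<close>, back to \<open>F\<close>. For \<open>UNIV\<close>
  the equality fails because of the number -1.\<close>

lemma pseudo_frobenius_eq_pf_gaps:
  assumes "numerical_semigroup S" and "S \<noteq> UNIV"
  shows "pseudo_frobenius S = int ` pf_gaps S"
proof
  show "int ` pf_gaps S \<subseteq> pseudo_frobenius S"
    by (auto simp: pf_gaps_def pseudo_frobenius_def simp flip: of_nat_add)
  show "pseudo_frobenius S \<subseteq> int ` pf_gaps S"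
  proof
    fix x assume x: "x \<in> pseudo_frobenius S"
    define F where "F = Max (- S)"
    have fin: "finite (- S)" and ne: "- S \<noteq> {}"
      using assms by (auto simp: numerical_semigroup_def)
    have F: "F \<notin> S" using Max_in[OF fin ne] by (simp add: F_def)
    have above: "y \<in> S" if "F < y" for y
      using Max_ge[OF fin, of y] that by (auto simp: F_def)
    have "0 \<le> x"
    proof (rule ccontr)
      assume "\<not> 0 \<le> x"
      then have "F + nat (- x) \<in> S - {0}" and eq: "x + int (F + nat (- x)) = int F"
        using above by auto
      then have "x + int (F + nat (- x)) \<in> int ` S"
        using x unfolding pseudo_frobenius_def by blast
      then show False using F eq by auto
    qed
    then obtain k where k: "x = int k" by (metis nonneg_int_cases)
    have "k \<in> pf_gaps S"
      using x unfolding k pf_gaps_def pseudo_frobenius_def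
      by (auto simp flip: of_nat_add)
    then show "x \<in> int ` pf_gaps S" using k by simp
  qed
qed

lemma semigroup_type_eq_card_pf_gaps:
  assumes "numerical_semigroup S" and "S \<noteq> UNIV"
  shows "semigroup_type S = card (pf_gaps S)"
  using pseudo_frobenius_eq_pf_gaps[OF assms]
  by (simp add: semigroup_type_def card_image)

lemma genus_pos_imp_ne_UNIV: "0 < genus S \<Longrightarrow> S \<noteq> UNIV"
  by (auto simp: genus_def)

lemma ex_multiplicity:
  assumes "numerical_semigroup S"
  shows "\<exists>m. is_multiplicity S m"
proof -
  have "infinite S"
    using assms unfolding numerical_semigroup_def
    by (metis finite_compl infinite_UNIV_nat)
  then have "\<exists>x. x \<in> S \<and> 0 < x"
    by (metis finite_nat_set_iff_bounded_le le0 not_gr_zero)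
  then have "is_multiplicity S (LEAST x. x \<in> S \<and> 0 < x)"
    unfolding is_multiplicity_def
    by (metis (mono_tags, lifting) LeastI_ex Least_le gr0I)
  then show ?thesis ..
qed

section \<open>Counting gaps when one of them is large\<close>

lemma type_bound_of_large_gap:
  assumes S: "numerical_semigroup S" and m: "is_multiplicity S m"
    and f: "f \<notin> S" "2 * m - 1 \<le> f"
  shows "3 * semigroup_type S + 1 \<le> 2 * genus S"
    and "2 * m \<le> f \<Longrightarrow> 3 * semigroup_type S + 2 \<le> 2 * genus S"
proof -
  define N where "N = - S - pf_gaps S"
  define lo where "lo = {p \<in> pf_gaps S. p < m}"
  define hi where "hi = {p \<in> pf_gaps S. m < p}"
  have fin: "finite (- S)" and add: "\<And>x y. x \<in> S \<Longrightarrow> y \<in> S \<Longrightarrow> x + y \<in> S" and z: "0 \<in> S"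
    using S by (auto simp: numerical_semigroup_def)
  have mS: "m \<in> S" "0 < m" using m by (auto simp: is_multiplicity_def)
  have finP: "finite (pf_gaps S)" using fin pf_gaps_subset by (rule finite_subset[rotated])
  have finN: "finite N" using fin by (simp add: N_def)
  have "genus S = card N + card (pf_gaps S)"
    unfolding genus_def N_def using card_Diff_subset[OF finP pf_gaps_subset]
      card_mono[OF fin pf_gaps_subset] by simp
  moreover have "S \<noteq> UNIV" using f by auto
  ultimately have g: "genus S = card N + semigroup_type S"
    and t: "semigroup_type S = card (pf_gaps S)"
    using semigroup_type_eq_card_pf_gaps[OF S] by auto
  have "m \<notin> pf_gaps S" using mS by (simp add: pf_gaps_def)
  then have "pf_gaps S = lo \<union> hi"
    unfolding lo_def hi_def by (auto) (metis linorder_neqE_nat)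
  moreover have "lo \<inter> hi = {}" by (auto simp: lo_def hi_def)
  ultimately have type: "semigroup_type S = card lo + card hi"
    using finP unfolding t by (simp add: card_Un_disjoint)
  \<comment> \<open>If \<open>x - l\<close> were in \<open>S\<close>, so would be the gap
    \<open>x\<close>; and adding \<open>l\<close> to \<open>x - l\<close> gives that gap, so
    \<open>x - l\<close> is not pseudo-Frobenius.\<close>
  have N_I: "x - l \<in> N" if "x \<notin> S" "l \<in> S" "l \<le> x" "l \<noteq> 0" for x l
    using that add[of "x - l" l] by (force simp: N_def pf_gaps_def)
  have "(\<lambda>p. p - m) ` hi \<subseteq> N"
    using N_I mS by (auto simp: hi_def pf_gaps_def)
  moreover have "inj_on (\<lambda>p. p - m) hi"
    by (auto simp: inj_on_def hi_def)
  ultimately have hi: "card hi \<le> card N" using card_inj_on_le finN by blast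
  let ?h = "\<lambda>p. f - (p + m)"
  \<comment> \<open>Here \<open>p + m\<close> is at most \<open>2 * m - 1\<close>, hence at most
    \<open>f\<close>, and it differs from \<open>f\<close> because it lies in \<open>S\<close>. So
    the subtraction in \<open>?h\<close> is never truncated.\<close>
  have lo_m: "p + m \<in> S" "p + m < f" "0 < p" "p < m" if "p \<in> lo" for p
  proof -
    show "p + m \<in> S" "p < m" using that mS by (auto simp: lo_def pf_gaps_def)
    then show "p + m < f" using f by (cases "p + m = f") auto
    show "0 < p" using that z by (cases p) (auto simp: lo_def pf_gaps_def)
  qed
  have img: "?h ` lo \<subseteq> N" using lo_m N_I[OF f(1)] by fastforce
  have "inj_on ?h lo"
    using lo_m by (fastforce simp: inj_on_def)
  then have ch: "card (?h ` lo) = card lo" by (rule card_image)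
  have fh: "finite (?h ` lo)" using img finN by (rule finite_subset)
  have fm: "f - m \<in> N" using N_I[OF f(1) mS(1)] f(2) mS by simp
  \<comment> \<open>Hitting \<open>f - m\<close> would require \<open>p = 0\<close>, which is not a
    gap.\<close>
  have nfm: "f - m \<notin> ?h ` lo" using lo_m by fastforce
  have "card (insert (f - m) (?h ` lo)) \<le> card N"
    using img fm finN by (intro card_mono) auto
  then have "card lo + 1 \<le> card N" using ch nfm fh by simp
  \<comment> \<open>With \<open>n = card N\<close> and type \<open>t\<close>, the genus is
    \<open>n + t\<close>, so the claim amounts to \<open>t + 1 \<le> 2 * n\<close>.\<close>
  then show "3 * semigroup_type S + 1 \<le> 2 * genus S" using g type hi by linarith
  show "3 * semigroup_type S + 2 \<le> 2 * genus S" if f2: "2 * m \<le> f"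
  proof -
    have fmm: "f - (m + m) \<in> N" using N_I[OF f(1) add[OF mS(1) mS(1)]] f2 mS by simp
    have nfmm: "f - (m + m) \<notin> insert (f - m) (?h ` lo)"
    proof
      assume "f - (m + m) \<in> insert (f - m) (?h ` lo)"
      then consider "f - (m + m) = f - m" | p where "p \<in> lo" "f - (m + m) = f - (p + m)" by auto
      then show False
      proof cases
        case 1 then show False using f2 mS by linarith
      next
        case 2 then show False using lo_m[OF 2(1)] f2 by linarith
      qed
    qed
    have "card (insert (f - (m + m)) (insert (f - m) (?h ` lo))) \<le> card N"
      using img fm fmm finN by (intro card_mono) auto
    then have "card lo + 2 \<le> card N" using ch nfm nfmm fh by simp
    then show ?thesis using g type hi by linarith
  qed
qed

section \<open>The upward shift\<close>

lemma Suc_in_shift_up [simp]: "Suc x \<in> shift_up S \<longleftrightarrow> x \<noteq> 0 \<and> x \<in> S"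
  and zero_in_shift_up [simp]: "0 \<in> shift_up S"
  by (auto simp: shift_up_def)

lemma in_shift_down_iff: "x \<in> shift_down S \<longleftrightarrow> x = 0 \<or> Suc x \<in> S"
  unfolding shift_down_def by (cases x) force+

text \<open>Reduces genus and type of the downward shift to the results on the upward one. An upward
  shift never contains 1.\<close>

lemma shift_up_shift_down:
  assumes "0 \<in> S" and "1 \<notin> S"
  shows "shift_up (shift_down S) = S"
proof (rule set_eqI)
  fix x show "x \<in> shift_up (shift_down S) \<longleftrightarrow> x \<in> S"
    using assms by (cases x) (auto simp: in_shift_down_iff intro: gr0I)
qed

text \<open>The extra gap is 1, because the element 0 stays in place.\<close>

lemma compl_shift_up:
  assumes "0 \<in> S"
  shows "- shift_up S = insert 1 (Suc ` (- S))"
proof (rule set_eqI)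
  fix x show "x \<in> - shift_up S \<longleftrightarrow> x \<in> insert 1 (Suc ` (- S))"
    using assms by (cases x) auto
qed

lemma genus_shift_up:
  assumes "numerical_semigroup S"
  shows "genus (shift_up S) = genus S + 1"
  using assms unfolding genus_def numerical_semigroup_def
  by (simp add: compl_shift_up card_image) (subst card_insert_disjoint, auto simp: card_image)

lemma numerical_semigroup_shift_up:
  assumes S: "numerical_semigroup S" and m: "is_multiplicity S m"
    and gap: "\<And>x. 2 * m \<le> x \<Longrightarrow> x \<in> S"
  shows "numerical_semigroup (shift_up S)"
proof -
  have "x + y \<in> shift_up S" if "x \<in> shift_up S" "y \<in> shift_up S" for x y
  proof (cases "x = 0 \<or> y = 0")
    case True then show ?thesis using that by auto
  next
    case False
    then obtain a b where ab: "x = Suc a" "y = Suc b" by (metis not0_implies_Suc)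
    with that m have "m \<le> a" "m \<le> b" by (auto simp: is_multiplicity_def)
    \<comment> \<open>The sum is \<open>Suc (Suc (a + b))\<close>, so it is
      \<open>Suc (a + b)\<close> that must lie in \<open>S\<close>; it exceeds
      \<open>2 * m\<close>.\<close>
    then have "Suc (a + b) \<in> S" using gap by simp
    then show ?thesis using ab by simp
  qed
  moreover have "finite (- shift_up S)"
    using S by (simp add: compl_shift_up numerical_semigroup_def)
  ultimately show ?thesis by (simp add: numerical_semigroup_def)
qed

lemma pf_gaps_shift_up:
  assumes S: "numerical_semigroup S" and m: "is_multiplicity S m"
    and gap: "\<And>x. 2 * m \<le> x \<Longrightarrow> x \<in> S"
  shows "pf_gaps (shift_up S) =
    insert m ({x \<in> pf_gaps S. x < m} \<union> Suc ` {x \<in> pf_gaps S. m < x})"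
proof (rule set_eqI)
  fix x
  have mS: "m \<in> S" "0 < m" and least: "\<And>l. l \<in> S \<Longrightarrow> 0 < l \<Longrightarrow> m \<le> l"
    and z: "0 \<in> S" and add: "\<And>a b. a \<in> S \<Longrightarrow> b \<in> S \<Longrightarrow> a + b \<in> S"
    using S m by (auto simp: is_multiplicity_def numerical_semigroup_def)
  \<comment> \<open>Sums with a shifted element \<open>Suc l\<close> lie in the shift exactly when
    \<open>x + l\<close> lies in \<open>S\<close>. So the same sums are tested for \<open>S\<close>
    and its shift; only the gaps differ.\<close>
  have up: "x \<in> pf_gaps (shift_up S) \<longleftrightarrow>
      x \<notin> shift_up S \<and> (\<forall>l\<in>S - {0}. x + l \<in> S)" for x
  proof -
    have "(\<forall>l \<in> shift_up S - {0}. x + l \<in> shift_up S) \<longleftrightarrow>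
        (\<forall>l\<in>S - {0}. x + Suc l \<in> shift_up S)"
      by (auto simp: shift_up_def)
    then show ?thesis by (auto simp: pf_gaps_def)
  qed
  have high: "x \<in> pf_gaps S \<longleftrightarrow> x \<notin> S" if "m \<le> x" for x
    using that gap least by (fastforce simp: pf_gaps_def)
  have low: "x \<notin> S" if "x < m" "x \<noteq> 0" for x using that least[of x] by auto
  consider "x < m" | "x = m" | y where "x = Suc y" "m \<le> y"
    by (cases x) (fastforce simp: not_less)+
  then show "x \<in> pf_gaps (shift_up S) \<longleftrightarrow>
    x \<in> insert m ({x \<in> pf_gaps S. x < m} \<union> Suc ` {x \<in> pf_gaps S. m < x})"
  proof cases
    case 1
    \<comment> \<open>Below \<open>m\<close> both sets contain only 0.\<close>
    then have "x \<in> shift_up S \<longleftrightarrow> x \<in> S"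
      using z low by (cases x) auto
    with 1 show ?thesis by (auto simp: up) (auto simp: pf_gaps_def)
  next
    case 2
    then have "x \<notin> shift_up S"
      using low[of "x - 1"] mS by (cases x) auto
    then show ?thesis using 2 add mS by (auto simp: up)
  next
    case (3 y)
    have "x + l \<in> S" if "l \<in> S" "0 < l" for l
      using gap least[OF that] 3 by simp
    then have "x \<in> pf_gaps (shift_up S) \<longleftrightarrow> y \<notin> S" using 3 mS by (auto simp: up)
    moreover have "y \<noteq> m" if "y \<notin> S" using that mS by auto
    moreover have "y \<in> pf_gaps S \<longleftrightarrow> y \<notin> S" using high 3 by blast
    ultimately show ?thesis using 3 mS by auto
  qed
qed

text \<open>The three pieces of \<open>pf_gaps_shift_up\<close> are disjoint: they lie below
  \<open>m\<close>, at \<open>m\<close> and above \<open>m + 1\<close>. For \<open>UNIV\<close> the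
  type stays 1, since -1 is lost as 1 is gained.\<close>

lemma semigroup_type_shift_up:
  assumes S: "numerical_semigroup S" and ne: "S \<noteq> UNIV" and m: "is_multiplicity S m"
    and gap: "\<And>x. 2 * m \<le> x \<Longrightarrow> x \<in> S"
  shows "semigroup_type (shift_up S) = semigroup_type S + 1"
proof -
  let ?lo = "{x \<in> pf_gaps S. x < m}" and ?hi = "{x \<in> pf_gaps S. m < x}"
  have fin: "finite (pf_gaps S)"
    using S finite_subset[OF pf_gaps_subset] by (auto simp: numerical_semigroup_def)
  have mS: "m \<notin> pf_gaps S" using m by (auto simp: is_multiplicity_def pf_gaps_def)
  then have "pf_gaps S = ?lo \<union> ?hi" by (auto) (metis linorder_neqE_nat)
  then have "card (pf_gaps S) = card (?lo \<union> ?hi)" by simp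
  also have "\<dots> = card ?lo + card ?hi"
    using fin by (intro card_Un_disjoint) auto
  also have "\<dots> = card (?lo \<union> Suc ` ?hi)"
    using fin by (subst card_Un_disjoint) (auto simp: card_image)
  finally have "card (pf_gaps S) + 1 = card (insert m (?lo \<union> Suc ` ?hi))"
    using fin by (subst card_insert_disjoint) auto
  moreover have "shift_up S \<noteq> UNIV"
    using genus_shift_up[OF S] by (intro genus_pos_imp_ne_UNIV) simp
  ultimately show ?thesis
    using semigroup_type_eq_card_pf_gaps[OF S ne] pf_gaps_shift_up[OF S m gap]
      semigroup_type_eq_card_pf_gaps[OF numerical_semigroup_shift_up[OF S m gap]]
    by simp
qed

section \<open>The downward shift\<close>

lemma numerical_semigroup_shift_down:
  assumes S: "numerical_semigroup S" and m: "is_multiplicity S m"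
    and gap: "\<And>x. 2 * m - 1 \<le> x \<Longrightarrow> x \<in> S"
  shows "numerical_semigroup (shift_down S)"
proof -
  have "x + y \<in> shift_down S" if "x \<in> shift_down S" "y \<in> shift_down S" for x y
  proof (cases "x = 0 \<or> y = 0")
    case True then show ?thesis using that by auto
  next
    case False
    with that m have "m \<le> Suc x" "m \<le> Suc y"
      by (auto simp: in_shift_down_iff is_multiplicity_def)
    \<comment> \<open>The element needed in \<open>S\<close> is \<open>Suc (x + y)\<close>, which is
      at least \<open>2 * m - 1\<close>, exactly the threshold of \<open>gap\<close>.\<close>
    then show ?thesis using gap by (simp add: in_shift_down_iff)
  qed
  moreover have "Suc ` (- shift_down S) \<subseteq> - S" by (auto simp: in_shift_down_iff)
  then have "finite (- shift_down S)"
    using S by (meson finite_imageD finite_subset inj_Suc inj_on_subset subset_UNIV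
        numerical_semigroup_def)
  ultimately show ?thesis by (simp add: numerical_semigroup_def in_shift_down_iff)
qed

lemma is_multiplicity_shift_down:
  assumes m: "is_multiplicity S m" and "1 \<notin> S"
  shows "is_multiplicity (shift_down S) (m - 1)"
proof -
  have "m \<noteq> 1" "0 < m" "m \<in> S" using assms by (auto simp: is_multiplicity_def)
  moreover have "m - 1 \<le> x" if "x \<in> shift_down S" "x \<noteq> 0" for x
  proof -
    have "Suc x \<in> S" using that by (auto simp: in_shift_down_iff)
    then have "m \<le> Suc x" using m by (auto simp: is_multiplicity_def)
    then show ?thesis by simp
  qed
  ultimately show ?thesis by (auto simp: is_multiplicity_def) (simp add: in_shift_down_iff)
qed


section \<open>Excluding large gaps by the inequality between type and genus\<close>

theorem theorem3p5:
  fixes g t :: nat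
  assumes "g \<ge> t" and "t > 0" and "real t \<ge> (2 * real g - 1) / 3"
  shows "(\<forall>\<Lambda>. numerical_semigroup \<Lambda> \<and> genus \<Lambda> = g \<and> semigroup_type \<Lambda> = t \<longrightarrow>
            (let \<Gamma> = {0} \<union> {x + 1 | x. x \<noteq> 0 \<and> x \<in> \<Lambda>} in
               numerical_semigroup \<Gamma> \<and> genus \<Gamma> = g + 1 \<and> semigroup_type \<Gamma> = t + 1)) \<and>
         (\<forall>\<Gamma>. numerical_semigroup \<Gamma> \<and> genus \<Gamma> = g + 1 \<and> semigroup_type \<Gamma> = t + 1 \<longrightarrow>
            (let \<Lambda> = {0} \<union> {x - 1 | x. x \<noteq> 0 \<and> x \<in> \<Gamma>} in
               numerical_semigroup \<Lambda> \<and> genus \<Lambda> = g \<and> semigroup_type \<Lambda> = t))"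
proof -
  have gt: "2 * g \<le> 3 * t + 1" using assms(3) by (simp add: field_simps)
  have gpos: "0 < g" using assms by simp
  have up: "numerical_semigroup (shift_up S) \<and> genus (shift_up S) = g + 1
      \<and> semigroup_type (shift_up S) = t + 1"
    if S: "numerical_semigroup S" "genus S = g" "semigroup_type S = t" for S
  proof -
    obtain m where m: "is_multiplicity S m" using ex_multiplicity[OF S(1)] ..
    have gap: "x \<in> S" if "2 * m \<le> x" for x
      using type_bound_of_large_gap(2)[OF S(1) m, of x] that S gt by force
    have "S \<noteq> UNIV" using S gpos by (intro genus_pos_imp_ne_UNIV) simp
    then show ?thesis
      using numerical_semigroup_shift_up[OF S(1) m gap] genus_shift_up[OF S(1)]
        semigroup_type_shift_up[OF S(1) _ m gap] S by simp
  qed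
  have down: "numerical_semigroup (shift_down S) \<and> genus (shift_down S) = g
      \<and> semigroup_type (shift_down S) = t"
    if S: "numerical_semigroup S" "genus S = g + 1" "semigroup_type S = t + 1" for S
  proof -
    obtain m where m: "is_multiplicity S m" using ex_multiplicity[OF S(1)] ..
    \<comment> \<open>A gap here would give \<open>3 * (t + 1) + 1 \<le> 2 * (g + 1)\<close>, that
      is \<open>3 * t + 2 \<le> 2 * g\<close>, against \<open>gt\<close>.\<close>
    have gap: "x \<in> S" if "2 * m - 1 \<le> x" for x
      using type_bound_of_large_gap(1)[OF S(1) m, of x] that S gt by force
    have "S \<noteq> UNIV" using S by (intro genus_pos_imp_ne_UNIV) simp
    then have one: "1 \<notin> S"
    proof (rule contrapos_nn)
      \<comment> \<open>With \<open>m = 1\<close> the threshold in \<open>gap\<close> is 1, so no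
        gap would remain.\<close>
      assume "1 \<in> S"
      then have "m = 1" using m by (force simp: is_multiplicity_def)
      then have "x \<in> S" for x using gap[of x] S(1) by (cases x) (auto simp: numerical_semigroup_def)
      then show "S = UNIV" by auto
    qed
    let ?D = "shift_down S"
    have D: "numerical_semigroup ?D" by (rule numerical_semigroup_shift_down[OF S(1) m gap])
    have mD: "is_multiplicity ?D (m - 1)" by (rule is_multiplicity_shift_down[OF m one])
    \<comment> \<open>The multiplicity drops by one, so twice it drops by two; passing to
      \<open>Suc x\<close> makes up one of these, and the threshold \<open>2 * m - 1\<close>
      supplies the other.\<close>
    have gapD: "x \<in> ?D" if "2 * (m - 1) \<le> x" for x
      using gap[of "Suc x"] that by (simp add: in_shift_down_iff)
    have UD: "shift_up ?D = S"
      using S(1) one by (intro shift_up_shift_down) (auto simp: numerical_semigroup_def)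
    have gD: "genus ?D = g" using genus_shift_up[OF D] UD S by simp
    \<comment> \<open>Positivity of \<open>g\<close> rules out the exceptional semigroup, whose type
      does not grow under the upward shift.\<close>
    then have "?D \<noteq> UNIV" using gpos by (intro genus_pos_imp_ne_UNIV) simp
    then have "semigroup_type ?D = t"
      using semigroup_type_shift_up[OF D _ mD gapD] UD S by simp
    with D gD show ?thesis by simp
  qed
  show ?thesis
    using up down by (simp add: Let_def shift_up_def shift_down_def)
qed

end
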